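(* Let $D_\varphi$ be a Brègman divergence. Let $\mathbf{x}_i,\mathbf{y}_i\in\mathbb{R}^{d_i}$ be vectors such that each pair $\mathbf{x}_i,\mathbf{y}_i$ is linearly independent, $i=1,2,3$, and let $$A=\mathbf{x}_1\otimes\mathbf{x}_2\otimes\mathbf{y}_3+\mathbf{x}_1\otimes\mathbf{y}_2\otimes\mathbf{x}_3+\mathbf{y}_1\otimes\mathbf{x}_2\otimes\mathbf{x}_3\in\mathbb{R}^{d_1\times d_2\times d_3},$$ $$A_n=n\Bigl(\mathbf{x}_1+\tfrac1n\mathbf{y}_1\Bigr)\otimes\Bigl(\mathbf{x}_2+\tfrac1n\mathbf{y}_2\Bigr)\otimes\Bigl(\mathbf{x}_3+\tfrac1n\mathbf{y}_3\Bigr)-n\,\mathbf{x}_1\otimes\mathbf{x}_2\otimes\mathbf{x}_3,\qquad n\in\mathbb{N}.$$ Then $$\lim_{n\to\infty}D_\varphi(A,A_n)=0=\lim_{n\to\infty}D_\varphi(A_n,A).$$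
   Context: $\mathbf{x}\otimes\mathbf{y}\otimes\mathbf{z}$ is the array with entries $x_iy_jz_k$. The relative interior $\operatorname{ri}(S)$ of a set $S$ is the interior of $S$ considered as a subset of its affine hull. Brègman divergence: let $S\subseteq\mathbb{R}^{d_1\times\dots\times d_k}$ be a convex set (here $k=3$) and let $\varphi:S\to\mathbb{R}$ be a lower semicontinuous, convex function that is continuously differentiable and strictly convex in $\operatorname{ri}(S)$, with the property that for any sequence $\{C_n\}\subset\operatorname{ri}(S)$ that converges to some $C\in S\setminus\operatorname{ri}(S)$ one has $\lim_{n\to\infty}\|\nabla\varphi(C_n)\|=+\infty$. The Brègman divergence $D_\varphi:S\times\operatorname{ri}(S)\to\mathbb{R}$ is defined by $$D_\varphi(X,Y)=\varphi(X)-\varphi(Y)-\langle\nabla\varphi(Y),X-Y\rangle .$$ *)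

theory Defs
  imports "HOL-Analysis.Analysis"
begin

text \<open>
  Arrays in \<open>\<real>\<^bsup>d\<^sub>1 \<times> d\<^sub>2 \<times> d\<^sub>3\<^esup>\<close> are elements of \<open>real ^ 'd3 ^ 'd2 ^ 'd1\<close>, whose
  library inner product and norm are the entrywise (Frobenius) ones.
\<close>

definition outer3 ::
    "real ^ 'd1 \<Rightarrow> real ^ 'd2 \<Rightarrow> real ^ 'd3 \<Rightarrow> real ^ 'd3 ^ 'd2 ^ 'd1" where
  "outer3 x y z = (\<chi> i j k. x $ i * y $ j * z $ k)"

text \<open>
  The function \<open>\<phi>\<close> is given on \<open>S\<close> only, and \<open>S\<close> need not be full-dimensional, so
  differentiation in \<open>ri(S)\<close> takes place inside the affine hull of \<open>S\<close>: the gradient is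
  the vector of the direction space of the affine hull that represents the derivative
  within \<open>S\<close>. It is unique at points of \<open>ri(S)\<close>, and at interior points of \<open>S\<close> it is
  the ordinary gradient; both facts are proved below. Values of \<open>\<phi>\<close> outside \<open>S\<close>
  play no role.
\<close>

definition has_gradient_on ::
    "('a::euclidean_space \<Rightarrow> real) \<Rightarrow> 'a \<Rightarrow> 'a set \<Rightarrow> 'a \<Rightarrow> bool" where
  "has_gradient_on \<phi> g S Y \<longleftrightarrow>
     g \<in> span ((\<lambda>X. X - Y) ` S) \<and> (\<phi> has_derivative (\<lambda>h. h \<bullet> g)) (at Y within S)"

definition gradient_on :: "('a::euclidean_space \<Rightarrow> real) \<Rightarrow> 'a set \<Rightarrow> 'a \<Rightarrow> 'a" where
  "gradient_on \<phi> S Y = (THE g. has_gradient_on \<phi> g S Y)"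

lemma has_gradient_on_unique:
  fixes S :: "'a::euclidean_space set"
  assumes Y: "Y \<in> rel_interior S"
    and g: "has_gradient_on \<phi> g S Y" and g': "has_gradient_on \<phi> g' S Y"
  shows "g = g'"
proof -
  define v where "v = g - g'"
  have YS: "Y \<in> S"
    by (rule subsetD[OF rel_interior_subset Y])
  have v: "v \<in> span ((\<lambda>X. X - Y) ` S)"
    unfolding v_def by (rule span_diff) (use g g' in \<open>simp_all add: has_gradient_on_def\<close>)
  obtain e where e: "e > 0" "cball Y e \<inter> affine hull S \<subseteq> S"
    using Y by (auto simp: mem_rel_interior_cball)
  have hull: "Y + t *\<^sub>R v \<in> affine hull S" for t
  proof -
    have "affine hull S = (+) Y ` span ((\<lambda>X. - Y + X) ` S)"
      by (rule affine_hull_span_gen) (rule hull_inc[OF YS])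
    moreover have "(\<lambda>X. - Y + X) ` S = (\<lambda>X. X - Y) ` S"
      by (intro image_cong) auto
    ultimately have "affine hull S = (+) Y ` span ((\<lambda>X. X - Y) ` S)"
      by (simp only:)
    then show ?thesis
      by (simp only:) (rule imageI[OF span_scale[OF v]])
  qed
  define d where "d = e / (norm v + 1)"
  have pos: "norm v + 1 > 0"
    using norm_ge_zero[of v] by linarith
  have d: "d > 0"
    using e(1) pos by (simp add: d_def)
  have line: "(\<lambda>t. Y + t *\<^sub>R v) ` {-d<..<d} \<subseteq> S"
  proof clarify
    fix t assume "t \<in> {-d<..<d}"
    then have "\<bar>t\<bar> * norm v \<le> d * (norm v + 1)"
      by (intro mult_mono) auto
    then have "Y + t *\<^sub>R v \<in> cball Y e"
      using pos by (simp add: d_def dist_norm)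
    then show "Y + t *\<^sub>R v \<in> S"
      by (intro subsetD[OF e(2)] IntI hull)
  qed
  have "((\<lambda>X. \<phi> X - \<phi> X) has_derivative (\<lambda>h. h \<bullet> g - h \<bullet> g')) (at Y within S)"
    by (rule has_derivative_diff) (use g g' in \<open>simp_all add: has_gradient_on_def\<close>)
  then have zero: "((\<lambda>X. 0) has_derivative (\<lambda>h. h \<bullet> v)) (at (Y + 0 *\<^sub>R v) within S)"
    by (simp add: v_def inner_diff_right)
  have aff: "((\<lambda>t. Y + t *\<^sub>R v) has_derivative (\<lambda>t. t *\<^sub>R v)) (at 0 within {-d<..<d})"
    by (auto intro!: derivative_eq_intros)
  have "((\<lambda>t::real. 0::real) has_derivative (\<lambda>t. t *\<^sub>R v \<bullet> v)) (at 0 within {-d<..<d})"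
    using has_derivative_in_compose[OF aff has_derivative_subset[OF zero line]] by simp
  then have "((\<lambda>t::real. 0::real) has_derivative (\<lambda>t. t *\<^sub>R v \<bullet> v)) (at 0)"
    using d by (simp add: at_within_open[of 0 "{-d<..<d}"])
  then have "(\<lambda>t. t *\<^sub>R v \<bullet> v) = (\<lambda>t::real. 0)"
    by (rule has_derivative_unique) simp
  from fun_cong[OF this, of 1] have "v \<bullet> v = 0"
    by simp
  then show ?thesis
    by (simp add: v_def)
qed

lemma gradient_on_eq:
  "Y \<in> rel_interior S \<Longrightarrow> has_gradient_on \<phi> g S Y \<Longrightarrow> gradient_on \<phi> S Y = g"
  unfolding gradient_on_def by (rule the_equality) (auto intro: has_gradient_on_unique)

lemma has_gradient_on_interior:
  fixes S :: "'a::euclidean_space set"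
  assumes "Y \<in> interior S"
  shows "has_gradient_on \<phi> g S Y \<longleftrightarrow> GDERIV \<phi> Y :> g"
proof -
  have "interior ((\<lambda>X. X - Y) ` S) \<noteq> {}"
    using assms by (auto simp: interior_translation_subtract)
  then have "affine hull ((\<lambda>X. X - Y) ` S) = UNIV"
    by (rule affine_hull_nonempty_interior)
  then have "span ((\<lambda>X. X - Y) ` S) = UNIV"
    using affine_hull_subset_span[of "(\<lambda>X. X - Y) ` S"] by (simp add: top.extremum_unique)
  then show ?thesis
    by (simp add: has_gradient_on_def gderiv_def at_within_interior[OF assms])
qed

definition lower_semicontinuous_on :: "'a::topological_space set \<Rightarrow> ('a \<Rightarrow> real) \<Rightarrow> bool" where
  "lower_semicontinuous_on S f \<longleftrightarrow>
     (\<forall>X\<in>S. \<forall>a<f X. \<forall>\<^sub>F Z in at X within S. a < f Z)"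

definition strictly_convex_on :: "'a::real_vector set \<Rightarrow> ('a \<Rightarrow> real) \<Rightarrow> bool" where
  "strictly_convex_on S f \<longleftrightarrow> convex S \<and>
     (\<forall>X\<in>S. \<forall>Z\<in>S. \<forall>u v. X \<noteq> Z \<and> u > 0 \<and> v > 0 \<and> u + v = 1 \<longrightarrow>
        f (u *\<^sub>R X + v *\<^sub>R Z) < u * f X + v * f Z)"

definition bregman_function :: "'a::euclidean_space set \<Rightarrow> ('a \<Rightarrow> real) \<Rightarrow> bool" where
  "bregman_function S \<phi> \<longleftrightarrow>
     convex S \<and>
     lower_semicontinuous_on S \<phi> \<and>
     convex_on S \<phi> \<and>
     (\<forall>Y\<in>rel_interior S. \<exists>g. has_gradient_on \<phi> g S Y) \<and>
     continuous_on (rel_interior S) (gradient_on \<phi> S) \<and>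
     strictly_convex_on (rel_interior S) \<phi> \<and>
     (\<forall>C L. (\<forall>n. C n \<in> rel_interior S) \<and> L \<in> S - rel_interior S \<and> C \<longlonglongrightarrow> L \<longrightarrow>
        filterlim (\<lambda>n. norm (gradient_on \<phi> S (C n))) at_top sequentially)"

text \<open>Meaningful for \<open>X \<in> S\<close> and \<open>Y \<in> rel_interior S\<close> only.\<close>

definition bregman_divergence ::
    "'a::euclidean_space set \<Rightarrow> ('a \<Rightarrow> real) \<Rightarrow> 'a \<Rightarrow> 'a \<Rightarrow> real" where
  "bregman_divergence S \<phi> X Y = \<phi> X - \<phi> Y - gradient_on \<phi> S Y \<bullet> (X - Y)"

end

theory Submission
  imports Defs
begin

text \<open>
  Expanding \<open>A\<^sub>n\<close> multilinearly, the terms of order \<open>n\<close> cancel and those of order \<open>1\<close> add up to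
  \<open>A\<close>, so \<open>A\<^sub>n\<close> converges to \<open>A\<close>. On the relative interior of \<open>S\<close> both \<open>\<phi>\<close> and its gradient are
  continuous, hence so is \<open>D\<^sub>\<phi>\<close>, which vanishes on the diagonal.
\<close>

text \<open>A gradient at \<open>Y\<close> entails differentiability within \<open>S\<close>, hence
  continuity within \<open>S\<close> and within every subset of \<open>S\<close> too.\<close>

lemma bregman_function_continuous_on:
  assumes "bregman_function S \<phi>"
  shows "continuous_on (rel_interior S) \<phi>"
  unfolding continuous_on_eq_continuous_within
proof
  fix Y assume "Y \<in> rel_interior S"
  then have "continuous (at Y within S) \<phi>"
    using assms by (auto simp: bregman_function_def has_gradient_on_def intro: has_derivative_continuous)
  then show "continuous (at Y within rel_interior S) \<phi>"
    by (rule continuous_within_subset) (rule rel_interior_subset)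
qed

text \<open>Both arguments are kept in the relative interior, where \<phi> and its gradient are
  continuous; elsewhere in \<open>S\<close> the definition provides only convexity and lower
  semicontinuity of \<phi>.\<close>

lemma bregman_divergence_tendsto:
  assumes \<phi>: "bregman_function S \<phi>"
    and A: "A \<in> rel_interior S" and B: "B \<in> rel_interior S"
    and f: "(f \<longlongrightarrow> A) F" "\<forall>\<^sub>F n in F. f n \<in> rel_interior S"
    and g: "(g \<longlongrightarrow> B) F" "\<forall>\<^sub>F n in F. g n \<in> rel_interior S"
  shows "((\<lambda>n. bregman_divergence S \<phi> (f n) (g n)) \<longlongrightarrow> bregman_divergence S \<phi> A B) F"
proof -
  have grad: "continuous_on (rel_interior S) (gradient_on \<phi> S)"
    using \<phi> by (simp add: bregman_function_def)
  note tendsto = continuous_on_tendsto_compose[OF bregman_function_continuous_on[OF \<phi>]]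
    continuous_on_tendsto_compose[OF grad]
  show ?thesis
    unfolding bregman_divergence_def
    by (intro tendsto_intros tendsto A B f g)
qed

text \<open>Multilinearity makes this curve a cubic polynomial in \<open>t\<close>; its linear
  coefficient is the array \<open>A\<close> of the theorem.\<close>

lemma outer3_add_scaleR:
  "outer3 (x1 + t *\<^sub>R y1) (x2 + t *\<^sub>R y2) (x3 + t *\<^sub>R y3) =
     outer3 x1 x2 x3
     + t *\<^sub>R (outer3 x1 x2 y3 + outer3 x1 y2 x3 + outer3 y1 x2 x3)
     + t\<^sup>2 *\<^sub>R (outer3 x1 y2 y3 + outer3 y1 x2 y3 + outer3 y1 y2 x3)
     + t ^ 3 *\<^sub>R outer3 y1 y2 y3"
  by (simp add: vec_eq_iff outer3_def algebra_simps power2_eq_square power3_eq_cube)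

text \<open>This is the difference quotient of the cubic curve at 0 with step
  \<open>1 / real n\<close>, so its limit is the linear coefficient.\<close>

lemma outer3_difference_quotient_tendsto:
  "(\<lambda>n. real n *\<^sub>R outer3 (x1 + (1 / real n) *\<^sub>R y1) (x2 + (1 / real n) *\<^sub>R y2)
                       (x3 + (1 / real n) *\<^sub>R y3)
       - real n *\<^sub>R outer3 x1 x2 x3)
     \<longlonglongrightarrow> outer3 x1 x2 y3 + outer3 x1 y2 x3 + outer3 y1 x2 x3"
  (is "?f \<longlonglongrightarrow> ?A")
proof -
  let ?B = "outer3 x1 y2 y3 + outer3 y1 x2 y3 + outer3 y1 y2 x3"
  have "(\<lambda>n. ?A + (1 / real n) *\<^sub>R ?B + (1 / real n)\<^sup>2 *\<^sub>R outer3 y1 y2 y3)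
          \<longlonglongrightarrow> ?A + 0 *\<^sub>R ?B + 0\<^sup>2 *\<^sub>R outer3 y1 y2 y3"
    by (intro tendsto_intros lim_1_over_n)
  then have lim: "(\<lambda>n. ?A + (1 / real n) *\<^sub>R ?B + (1 / real n)\<^sup>2 *\<^sub>R outer3 y1 y2 y3) \<longlonglongrightarrow> ?A"
    by simp
  \<comment> \<open>Multiplying by \<open>n\<close> lowers each power of \<open>1 / real n\<close>
    by one. At \<open>n = 0\<close> division by zero yields 0, so the left side is \<open>?A\<close>
    while \<open>?f 0\<close> is 0.\<close>
  have "?A + (1 / real n) *\<^sub>R ?B + (1 / real n)\<^sup>2 *\<^sub>R outer3 y1 y2 y3 = ?f n" if "n \<ge> 1" for n
    using that unfolding outer3_add_scaleR
    by (simp add: scaleR_add_right power2_eq_square power3_eq_cube)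
  then have "\<forall>\<^sub>F n in sequentially.
      ?A + (1 / real n) *\<^sub>R ?B + (1 / real n)\<^sup>2 *\<^sub>R outer3 y1 y2 y3 = ?f n"
    by (auto simp: eventually_sequentially)
  with lim show ?thesis
    by (rule Lim_transform_eventually)
qed

theorem proposition4p14:
  fixes S :: "(real ^ 'd3 ^ 'd2 ^ 'd1) set"
    and \<phi> :: "real ^ 'd3 ^ 'd2 ^ 'd1 \<Rightarrow> real"
    and x1 y1 :: "real ^ 'd1"
    and x2 y2 :: "real ^ 'd2"
    and x3 y3 :: "real ^ 'd3"
    and A :: "real ^ 'd3 ^ 'd2 ^ 'd1"
    and As :: "nat \<Rightarrow> real ^ 'd3 ^ 'd2 ^ 'd1"
  assumes "bregman_function S \<phi>"
    and "x1 \<noteq> y1" and "independent {x1, y1}"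
    and "x2 \<noteq> y2" and "independent {x2, y2}"
    and "x3 \<noteq> y3" and "independent {x3, y3}"
    and "A = outer3 x1 x2 y3 + outer3 x1 y2 x3 + outer3 y1 x2 x3"
    and "\<And>n. n \<ge> 1 \<Longrightarrow> As n =
           real n *\<^sub>R outer3 (x1 + (1 / real n) *\<^sub>R y1) (x2 + (1 / real n) *\<^sub>R y2)
                         (x3 + (1 / real n) *\<^sub>R y3)
           - real n *\<^sub>R outer3 x1 x2 x3"
    and "A \<in> rel_interior S"
    and "\<forall>\<^sub>F n in sequentially. As n \<in> rel_interior S"
  shows "(\<lambda>n. bregman_divergence S \<phi> A (As n)) \<longlonglongrightarrow> 0 \<and>
         (\<lambda>n. bregman_divergence S \<phi> (As n) A) \<longlonglongrightarrow> 0"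
proof -
  have "\<forall>\<^sub>F n in sequentially.
      real n *\<^sub>R outer3 (x1 + (1 / real n) *\<^sub>R y1) (x2 + (1 / real n) *\<^sub>R y2)
                    (x3 + (1 / real n) *\<^sub>R y3)
        - real n *\<^sub>R outer3 x1 x2 x3 = As n"
    using eventually_ge_at_top[of 1] by eventually_elim (simp only: assms(9))
  with outer3_difference_quotient_tendsto have "As \<longlonglongrightarrow> A"
    unfolding assms(8) by (rule Lim_transform_eventually)
  moreover have "bregman_divergence S \<phi> A A = 0"
    by (simp add: bregman_divergence_def)
  ultimately show ?thesis
    \<comment> \<open>Joint continuity is applied twice, with the constant sequence \<open>A\<close>
      in one argument and \<open>As\<close> in the other.\<close>
    using bregman_divergence_tendsto[of S \<phi> A A "\<lambda>_. A" sequentially As]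
      bregman_divergence_tendsto[of S \<phi> A A As sequentially "\<lambda>_. A"] assms(1,10,11)
    by simp
qed

end
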